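(* Let $n,d$ be positive integers with $d\geq 3$ and $n\equiv 1\pmod d$, and let $a,b$ be indeterminates. For $k\geq 0$ let $$z_q(k)=[2dk+1]\frac{(q,aq,q/a,q/b;q^d)_k}{(q^d,aq^d,q^d/a,bq^d;q^d)_k}b^kq^{(d-2)k}.$$ Then $$\sum_{i+j+k\leq n-1}z_q(i)z_q(j)z_q(k)\equiv [n]^3\frac{(q,q^{d-1};q^d)^3_{\frac{n-1}{d}}}{(aq^d,q^d/a;q^d)^3_{\frac{n-1}{d}}}\pmod{b-q^n},$$ where the sum runs over all triples of nonnegative integers $(i,j,k)$ with $i+j+k\leq n-1$.
   Context: $q$ is an indeterminate. The $q$-integer is $[m]=1+q+\cdots+q^{m-1}$. The $q$-shifted factorial is $(x;q)_0=1$, $(x;q)_m=(1-x)(1-xq)\cdots(1-xq^{m-1})$, $(x;q)^r_m$ denotes its $r$-th power, and $(x_1,\dots,x_r;q)_m=(x_1;q)_m\cdots(x_r;q)_m$. A congruence $A\equiv B\pmod{P}$ between rational functions in $q,a,b$ means that $A-B$ can be written as a fraction whose numerator is divisible by the polynomial $P$ and whose denominator is coprime to $P$. *)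

theory Defs
  imports
    "HOL-Computational_Algebra.Computational_Algebra"
    "HOL-Number_Theory.Cong"
begin

definition q_int :: "'a::comm_ring_1 \<Rightarrow> nat \<Rightarrow> 'a" where
  "q_int q m = (\<Sum>i<m. q ^ i)"

definition q_poch :: "'a::comm_ring_1 \<Rightarrow> 'a \<Rightarrow> nat \<Rightarrow> 'a" where
  "q_poch x q m = (\<Prod>i<m. 1 - x * q ^ i)"

definition q_pochs :: "'a::comm_ring_1 list \<Rightarrow> 'a \<Rightarrow> nat \<Rightarrow> 'a" where
  "q_pochs xs q m = (\<Prod>x\<leftarrow>xs. q_poch x q m)"

text \<open>Polynomials in \<open>q\<close>, \<open>a\<close>, \<open>b\<close> are iterated univariate polynomials: the innermost
  variable is \<open>q\<close>, the outermost \<open>b\<close>. Rational functions are the fraction field of this ring,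
  which is the field of rational functions over the rationals.\<close>

type_synonym poly_qab = "int poly poly poly"
type_synonym ratfun_qab = "poly_qab fract"

definition polyq :: poly_qab where "polyq = [:[:[:0, 1:]:]:]"
definition polyb :: poly_qab where "polyb = [:0, 1:]"

definition varq :: ratfun_qab where "varq = to_fract polyq"
definition vara :: ratfun_qab where "vara = to_fract [:[:0, 1:]:]"
definition varb :: ratfun_qab where "varb = to_fract polyb"

definition fract_cong :: "'a::idom_divide poly fract \<Rightarrow> 'a poly fract \<Rightarrow> 'a poly \<Rightarrow> bool" where
  "fract_cong A B P \<longleftrightarrow>
     (\<exists>N D. D \<noteq> 0 \<and> A - B = Fract N D \<and> P dvd N \<and> coprime D P)"

definition z_q :: "nat \<Rightarrow> nat \<Rightarrow> ratfun_qab" where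
  "z_q d k =
     (let q = varq; a = vara; b = varb in
      q_int q (2 * d * k + 1)
        * (q_pochs [q, a * q, q / a, q / b] (q ^ d) k
           / q_pochs [q ^ d, a * q ^ d, q ^ d / a, b * q ^ d] (q ^ d) k)
        * b ^ k * q ^ ((d - 2) * k))"

end

theory Submission imports Defs begin

text \<open>
  Modulo \<open>b - q\<^sup>n\<close> one may substitute \<open>b = q\<^sup>n\<close>. Put \<open>m = (n - 1) / d\<close>. Then
  \<open>(q/b; q\<^sup>d)\<^sub>k = (q\<^sup>-\<^sup>d\<^sup>m; q\<^sup>d)\<^sub>k\<close> vanishes for \<open>k > m\<close>, and since \<open>3 m \<le> d m = n - 1\<close>, the constraint
  on the triples is vacuous on the surviving terms: the triple sum is the cube of the sum of
  \<open>z\<^sub>q(k)\<close> over \<open>k \<le> m\<close>. That sum is a terminating very-well-poised \<open>\<^sub>6\<phi>\<^sub>5\<close> series, which is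
  evaluated by induction on the length \<open>N\<close>, using a Wilf--Zeilberger certificate.
\<close>

section \<open>Elementary identities for q-shifted factorials\<close>

lemma q_poch_0 [simp]: "q_poch x q 0 = 1"
  by (simp add: q_poch_def)

lemma q_poch_Suc: "q_poch x q (Suc m) = q_poch x q m * (1 - x * q ^ m)"
  by (simp add: q_poch_def)

lemma q_poch_Suc_shift: "q_poch x q (Suc m) = (1 - x) * q_poch (x * q) q m"
  unfolding q_poch_def by (subst prod.lessThan_Suc_shift) (simp add: ac_simps)

lemma q_poch_nonzero:
  fixes x q :: "'a::idom"
  assumes "\<And>i. x * q ^ i \<noteq> 1"
  shows "q_poch x q m \<noteq> 0"
  using assms by (simp add: q_poch_def)

lemma q_poch_inverse_power_eq_0:
  fixes q :: "'a::field"
  assumes "q \<noteq> 0" and "N < k"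
  shows "q_poch (1 / q ^ N) q k = 0"
  unfolding q_poch_def using assms by (intro prod_zero) auto

lemma q_int_mult: "(1 - q) * q_int q m = 1 - q ^ m"
  by (simp add: q_int_def one_diff_power_eq)

section \<open>The terminating very-well-poised 6phi5 summation\<close>

text \<open>The summand of the \<open>\<^sub>6\<phi>\<^sub>5\<close> series, multiplied by \<open>1 - A\<close>. Here \<open>x\<close> stands for \<open>Q\<^sup>N\<close>.\<close>

definition vwp_term :: "'a::field \<Rightarrow> 'a \<Rightarrow> 'a \<Rightarrow> 'a \<Rightarrow> 'a \<Rightarrow> nat \<Rightarrow> 'a" where
  "vwp_term A B C Q x k =
     (1 - A * Q ^ (2 * k))
       * (q_poch A Q k * q_poch B Q k * q_poch C Q k * q_poch (1 / x) Q k)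
       / (q_poch Q Q k * q_poch (A * Q / B) Q k * q_poch (A * Q / C) Q k * q_poch (A * x * Q) Q k)
       * (A * x * Q / (B * C)) ^ k"

text \<open>With X = x Q and p = Q^(M+1), this is the induction step of
  \<open>vwp_contiguous_sum\<close> divided by its right-hand side at M: the left side comes from
  the summand k = M + 1, the right side is the ratio of consecutive certificates minus 1.\<close>

lemma vwp_certificate_identity:
  fixes A B C X p :: "'a::field"
  assumes "B \<noteq> 0" "C \<noteq> 0" "X \<noteq> 0"
    and "1 - p \<noteq> 0" "1 - A * p / B \<noteq> 0" "1 - A * p / C \<noteq> 0" "1 - A * X * p \<noteq> 0"
  shows "(1 - A * p\<^sup>2) / ((1 - p) * (1 - A * p / B) * (1 - A * p / C))
           * ((1 - A * X / B) * (1 - A * X / C) * (1 - 1 / X) * p / (1 - A * X * p)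
              - (1 - A * X / (B * C)) * (1 - p / X))
         = (1 - A * p) * (1 - B * p) * (1 - C * p) * (1 - p / X) * (A * X / (B * C))
             / ((1 - p) * (1 - A * p / B) * (1 - A * p / C) * (1 - A * X * p)) - 1"
proof -
  have e: "1 - A * p / B = (B - A * p) / B" "1 - A * p / C = (C - A * p) / C"
    "1 - p / X = (X - p) / X"  "1 - A * X / B = (B - A * X) / B" "1 - A * X / C = (C - A * X) / C"
    "1 - 1 / X = (X - 1) / X" "1 - A * X / (B * C) = (B * C - A * X) / (B * C)"
    using assms by (simp_all add: field_simps)
  have nz: "B - A * p \<noteq> 0" "C - A * p \<noteq> 0"
    using assms by (auto simp: e)
  show ?thesis
    unfolding e using assms(1-4,7) nz by (simp add: divide_simps) algebra
qed

text \<open>The coefficients are those of the first-order recurrence in N satisfied by the closed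
  form of the 6phi5 sum, with Q^N replaced by a free x. This combination of summands telescopes, and
  the right-hand side is the certificate.\<close>

lemma vwp_contiguous_sum:
  fixes A B C Q x :: "'a::field"
  assumes nz: "B \<noteq> 0" "C \<noteq> 0" "Q \<noteq> 0" "x \<noteq> 0"
    and Q: "\<And>i. Q * Q ^ i \<noteq> 1"
    and B: "\<And>i. A * Q / B * Q ^ i \<noteq> 1"
    and C: "\<And>i. A * Q / C * Q ^ i \<noteq> 1"
    and x: "\<And>i. A * x * Q * Q ^ i \<noteq> 1"
  shows "(\<Sum>k\<le>M. (1 - A * x * Q / B) * (1 - A * x * Q / C) * vwp_term A B C Q (x * Q) k
                 - (1 - A * x * Q) * (1 - A * x * Q / (B * C)) * vwp_term A B C Q x k)
       = q_poch A Q (Suc M) * q_poch B Q (Suc M) * q_poch C Q (Suc M) * q_poch (1 / x) Q M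
           / (q_poch Q Q M * q_poch (A * Q / B) Q M * q_poch (A * Q / C) Q M
              * q_poch (A * x * Q * Q) Q M)
           * (A * x * Q / (B * C)) ^ Suc M"
    (is "_ = ?G M")
proof (induction M)
  case 0
  \<comment> \<open>For k = 0 the two coefficients differ by (1 - B)(1 - C) A x Q / (B C).\<close>
  show ?case using nz
    by (simp add: vwp_term_def q_poch_Suc field_simps)
next
  case (Suc M)
  \<comment> \<open>Every term of the step becomes \<open>Z\<close>, the certificate at M, times a
    rational function of A, B, C, X and p.\<close>
  define X where "X = x * Q"
  define p where "p = Q ^ Suc M"
  define w where "w = A * X / (B * C)"
  define a b c y where "a = q_poch A Q (Suc M)" and "b = q_poch B Q (Suc M)"
    and "c = q_poch C Q (Suc M)" and "y = q_poch (1 / x) Q M"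
  define e f g h where "e = q_poch Q Q M" and "f = q_poch (A * Q / B) Q M"
    and "g = q_poch (A * Q / C) Q M" and "h = q_poch (A * X * Q) Q M"
  define Z where "Z = a * b * c * y / (e * f * g * h) * w ^ Suc M"
  have X: "X \<noteq> 0" "1 - A * X \<noteq> 0" "1 - A * X * p \<noteq> 0"
    using nz x[of 0] x[of "Suc M"] by (auto simp: X_def p_def mult.assoc)
  have p: "1 - p \<noteq> 0" "1 - A * p / B \<noteq> 0" "1 - A * p / C \<noteq> 0"
    using Q[of M] B[of M] C[of M] by (auto simp: p_def)
  \<comment> \<open>Parameters differing by a factor Q give factorials that share all but their end
    factors. Splitting off the first or the last factor reduces those of A X and A X Q to
    \<open>h\<close>; in \<open>num\<close>, Q / X = 1 / x reduces those of 1 / X and 1 / x to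
    \<open>y\<close>.\<close>
  have den: "q_poch Q Q (Suc M) = e * (1 - p)" "q_poch (A * Q / B) Q (Suc M) = f * (1 - A * p / B)"
    "q_poch (A * Q / C) Q (Suc M) = g * (1 - A * p / C)"
    "q_poch (A * X * Q) Q (Suc M) = h * (1 - A * X * p)"
    "q_poch (A * X) Q (Suc M) = (1 - A * X) * h"
    by (simp_all only: q_poch_Suc_shift[of "A * X"])
      (simp_all add: q_poch_Suc p_def e_def f_def g_def h_def mult.assoc)
  have num: "q_poch (1 / X) Q (Suc M) = (1 - 1 / X) * y"
    "q_poch (1 / x) Q (Suc M) = y * (1 - p / X)"
    using nz by (simp_all only: q_poch_Suc_shift[of "1 / X"])
      (simp_all add: q_poch_Suc X_def p_def y_def)
  have p2: "Q ^ (2 * Suc M) = p\<^sup>2"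
    by (simp only: p_def power_mult[symmetric] mult.commute)
  have wQ: "(A * X * Q / (B * C)) ^ Suc M = w ^ Suc M * p"
    unfolding p_def w_def power_mult_distrib[symmetric] by simp
  have t1: "vwp_term A B C Q (x * Q) (Suc M)
    = (1 - A * p\<^sup>2) * (a * b * c * ((1 - 1 / X) * y))
        / (e * (1 - p) * (f * (1 - A * p / B)) * (g * (1 - A * p / C)) * (h * (1 - A * X * p)))
        * (w ^ Suc M * p)"
    unfolding vwp_term_def p2 X_def[symmetric] wQ den num a_def b_def c_def ..
  have t0: "vwp_term A B C Q x (Suc M)
    = (1 - A * p\<^sup>2) * (a * b * c * (y * (1 - p / X)))
        / (e * (1 - p) * (f * (1 - A * p / B)) * (g * (1 - A * p / C)) * ((1 - A * X) * h))
        * w ^ Suc M"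
    unfolding vwp_term_def p2 mult.assoc[of A x Q] X_def[symmetric] den num a_def b_def c_def w_def ..
  have G1: "?G (Suc M) = Z * ((1 - A * p) * (1 - B * p) * (1 - C * p) * (1 - p / X) * w
             / ((1 - p) * (1 - A * p / B) * (1 - A * p / C) * (1 - A * X * p)))"
    unfolding mult.assoc[of A x Q] X_def[symmetric] den num
    unfolding q_poch_Suc[of _ _ "Suc M"] p_def[symmetric] a_def[symmetric] b_def[symmetric]
      c_def[symmetric] w_def[symmetric] Z_def
    by (simp add: ac_simps)
  have G0: "?G M = Z"
    unfolding Z_def a_def b_def c_def y_def e_def f_def g_def h_def w_def X_def by (simp add: mult.assoc)
  let ?D = "(1 - p) * (1 - A * p / B) * (1 - A * p / C)"
  have f1: "vwp_term A B C Q (x * Q) (Suc M)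
      = Z * ((1 - A * p\<^sup>2) / ?D * ((1 - 1 / X) * p / (1 - A * X * p)))"
    unfolding t1 Z_def by (simp add: ac_simps)
  have f0: "(1 - A * X) * vwp_term A B C Q x (Suc M) = Z * ((1 - A * p\<^sup>2) / ?D * (1 - p / X))"
    unfolding t0 Z_def using X(2) by (simp add: ac_simps)
  have factor: "u * (Z * (K * s)) - v * (Z * (K * t)) = Z * (K * (u * s - v * t))" for u v K s t
    by (simp add: algebra_simps)
  have "(1 - A * x * Q / B) * (1 - A * x * Q / C) * vwp_term A B C Q (x * Q) (Suc M)
          - (1 - A * x * Q) * (1 - A * x * Q / (B * C)) * vwp_term A B C Q x (Suc M)
      = (1 - A * X / B) * (1 - A * X / C) * vwp_term A B C Q (x * Q) (Suc M)
          - (1 - A * X / (B * C)) * ((1 - A * X) * vwp_term A B C Q x (Suc M))"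
    unfolding X_def by (simp add: mult.assoc mult.left_commute)
  also have "\<dots> = Z * ((1 - A * p\<^sup>2) / ?D
       * ((1 - A * X / B) * (1 - A * X / C) * (1 - 1 / X) * p / (1 - A * X * p)
              - (1 - A * X / (B * C)) * (1 - p / X)))"
    unfolding f1 f0 factor by (simp only: times_divide_eq_right mult.assoc)
  also have "\<dots> = Z * ((1 - A * p) * (1 - B * p) * (1 - C * p) * (1 - p / X) * w / (?D * (1 - A * X * p)) - 1)"
    unfolding w_def by (subst vwp_certificate_identity) (use nz X p in auto)
  also have "\<dots> = ?G (Suc M) - ?G M"
    unfolding G1 G0 by (simp add: right_diff_distrib)
  finally show ?case
    by (simp only: sum.atMost_Suc Suc.IH) simp
qed

text \<open>Induction on N, using \<open>vwp_contiguous_sum\<close> at x = Q^N and M = N + 1. The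
  usual denominator 1 - A is cleared, so (A; Q)_(N+1) stands in place of (A Q; Q)_N.\<close>

theorem terminating_6phi5_sum:
  fixes A B C Q :: "'a::field"
  assumes nz: "B \<noteq> 0" "C \<noteq> 0" "Q \<noteq> 0"
    and Q: "\<And>i. Q * Q ^ i \<noteq> 1"
    and A: "\<And>i. A * Q * Q ^ i \<noteq> 1"
    and B: "\<And>i. A * Q / B * Q ^ i \<noteq> 1"
    and C: "\<And>i. A * Q / C * Q ^ i \<noteq> 1"
  shows "(\<Sum>k\<le>N. vwp_term A B C Q (Q ^ N) k)
       = q_poch A Q (Suc N) * q_poch (A * Q / (B * C)) Q N
           / (q_poch (A * Q / B) Q N * q_poch (A * Q / C) Q N)"
proof (induction N)
  case 0
  show ?case by (simp add: vwp_term_def q_poch_Suc)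
next
  case (Suc N)
  let ?x = "Q ^ N"
  let ?S = "\<Sum>k\<le>Suc N. vwp_term A B C Q (Q ^ Suc N) k"
  \<comment> \<open>This zero serves twice: it removes the extra summand k = N + 1 at x = Q^N, and
    it makes the telescoped sum vanish.\<close>
  have "q_poch (1 / Q ^ N) Q (Suc N) = 0"
    using nz by (intro q_poch_inverse_power_eq_0) auto
  then have last: "vwp_term A B C Q ?x (Suc N) = 0"
    by (simp add: vwp_term_def)
  have "(\<Sum>k\<le>Suc N. (1 - A * ?x * Q / B) * (1 - A * ?x * Q / C) * vwp_term A B C Q (?x * Q) k
              - (1 - A * ?x * Q) * (1 - A * ?x * Q / (B * C)) * vwp_term A B C Q ?x k) = 0"
  proof (subst vwp_contiguous_sum)
    show "A * ?x * Q * Q ^ i \<noteq> 1" for i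
      using A[of "N + i"] by (simp add: power_add ac_simps)
  qed (use nz Q B C q_poch_inverse_power_eq_0[OF nz(3), of N "Suc N"] in auto)
  then have "(1 - A * ?x * Q / B) * (1 - A * ?x * Q / C) * ?S
      = (1 - A * ?x * Q) * (1 - A * ?x * Q / (B * C)) * (\<Sum>k\<le>N. vwp_term A B C Q ?x k)"
    unfolding sum_subtractf sum_distrib_left[symmetric] using last
    by (simp add: mult.commute[of Q ?x])
  moreover have "1 - A * ?x * Q / B \<noteq> 0" "1 - A * ?x * Q / C \<noteq> 0"
    using B[of N] C[of N] by (auto simp: ac_simps)
  ultimately have "?S = (1 - A * ?x * Q) * (1 - A * ?x * Q / (B * C))
      * (\<Sum>k\<le>N. vwp_term A B C Q ?x k) / ((1 - A * ?x * Q / B) * (1 - A * ?x * Q / C))"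
    by (simp add: nonzero_eq_divide_eq ac_simps)
  then show ?case
    unfolding Suc.IH q_poch_Suc by (simp add: ac_simps)
qed

section \<open>Specialisation of the summand at b = q^n\<close>

text \<open>Field elements replace the indeterminates, so that one formula covers both the original
  summand and its value at b = q^n, which lies in another field.\<close>

definition z_gen :: "'a::field \<Rightarrow> 'a \<Rightarrow> 'a \<Rightarrow> nat \<Rightarrow> nat \<Rightarrow> 'a" where
  "z_gen q a b d k =
     q_int q (2 * d * k + 1)
       * (q_pochs [q, a * q, q / a, q / b] (q ^ d) k
          / q_pochs [q ^ d, a * q ^ d, q ^ d / a, b * q ^ d] (q ^ d) k)
       * b ^ k * q ^ ((d - 2) * k)"

lemma z_q_eq_z_gen: "z_q d = z_gen varq vara varb d"
  by (simp add: fun_eq_iff z_q_def z_gen_def Let_def)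

text \<open>The factorials match because A Q / B = q^d / a, A Q / C = a q^d, A x = q^n = b and 1 / x
  = q / b; the factor 1 - q turns the q-integer into 1 - A Q^(2k).\<close>

lemma z_gen_eq_vwp_term:
  fixes q a :: "'a::field"
  assumes nz: "q \<noteq> 0" "a \<noteq> 0" and d: "d \<ge> 2" and n: "n = Suc (d * m)"
  shows "(1 - q) * z_gen q a (q ^ n) d k = vwp_term q (a * q) (q / a) (q ^ d) ((q ^ d) ^ m) k"
proof -
  have qn: "q * (q ^ d) ^ m = q ^ n"
    by (simp add: n power_mult)
  have e1: "q ^ (2 * d * k + 1) = q * (q ^ d) ^ (2 * k)"
    by (simp add: power_mult[symmetric] ac_simps)
  have e2: "q / q ^ n = 1 / (q ^ d) ^ m"
    using nz by (simp add: n power_mult)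
  have e3: "q * q ^ d / (a * q) = q ^ d / a" "q * q ^ d / (q / a) = a * q ^ d"
    using nz by simp_all
  \<comment> \<open>Since B C = q^2, the argument A x Q / (B C) equals b q^(d-2).\<close>
  have "q ^ d = q ^ (d - 2) * q\<^sup>2"
    using d by (simp only: power_add[symmetric] le_add_diff_inverse2)
  then have "q ^ n * q ^ d / (a * q * (q / a)) = q ^ n * q ^ (d - 2)"
    using nz by (simp add: power2_eq_square)
  then have e4: "(q ^ n * q ^ d / (a * q * (q / a))) ^ k = (q ^ n) ^ k * q ^ ((d - 2) * k)"
    by (simp only: power_mult_distrib power_mult)
  have "(1 - q) * z_gen q a (q ^ n) d k
      = (1 - q ^ (2 * d * k + 1))
          * (q_pochs [q, a * q, q / a, q / q ^ n] (q ^ d) k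
             / q_pochs [q ^ d, a * q ^ d, q ^ d / a, q ^ n * q ^ d] (q ^ d) k)
          * ((q ^ n) ^ k * q ^ ((d - 2) * k))"
    unfolding z_gen_def q_int_mult[symmetric] by (simp only: mult.assoc)
  also have "\<dots> = vwp_term q (a * q) (q / a) (q ^ d) ((q ^ d) ^ m) k"
    unfolding vwp_term_def qn e1 e2 e3 e4 by (simp add: q_pochs_def ac_simps)
  finally show ?thesis .
qed

lemma z_gen_eq_0:
  fixes q a :: "'a::field"
  assumes "q \<noteq> 0" and "n = Suc (d * m)" and "m < k"
  shows "z_gen q a (q ^ n) d k = 0"
proof -
  have "q / q ^ n = 1 / (q ^ d) ^ m"
    using assms by (simp add: power_mult)
  then show ?thesis
    using assms q_poch_inverse_power_eq_0[of "q ^ d" m k] by (simp add: z_gen_def q_pochs_def)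
qed

lemma sum_z_gen:
  fixes q a :: "'a::field"
  assumes q0: "q \<noteq> 0" and a0: "a \<noteq> 0" and q: "\<And>i. i > 0 \<Longrightarrow> q ^ i \<noteq> 1"
    and aq: "\<And>i. a * q ^ i \<noteq> 1" and a: "\<And>i. a \<noteq> q ^ i"
    and d: "d \<ge> 2" and n: "n = Suc (d * m)"
  shows "(\<Sum>k\<le>m. z_gen q a (q ^ n) d k)
       = q_int q n * (q_pochs [q, q ^ (d - 1)] (q ^ d) m
                        / q_pochs [a * q ^ d, q ^ d / a] (q ^ d) m)"
proof -
  have q1: "1 - q \<noteq> 0"
    using q[of 1] by simp
  have "q ^ d = q * q ^ (d - 1)"
    using d by (simp flip: power_Suc)
  then have e: "q * q ^ d / (a * q) = q ^ d / a" "q * q ^ d / (q / a) = a * q ^ d"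
    "q * q ^ d / (a * q * (q / a)) = q ^ (d - 1)"
    using q0 a0 by simp_all
  have "(1 - q) * (\<Sum>k\<le>m. z_gen q a (q ^ n) d k)
      = (\<Sum>k\<le>m. vwp_term q (a * q) (q / a) (q ^ d) ((q ^ d) ^ m) k)"
    unfolding sum_distrib_left z_gen_eq_vwp_term[OF q0 a0 d n] ..
  also have "\<dots> = q_poch q (q ^ d) (Suc m) * q_poch (q * q ^ d / (a * q * (q / a))) (q ^ d) m
      / (q_poch (q * q ^ d / (a * q)) (q ^ d) m * q_poch (q * q ^ d / (q / a)) (q ^ d) m)"
  proof (rule terminating_6phi5_sum)
    fix i
    show "q ^ d * (q ^ d) ^ i \<noteq> 1"
      using q[of "d + d * i"] d by (simp add: power_add power_mult)
    show "q * q ^ d * (q ^ d) ^ i \<noteq> 1"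
      using q[of "Suc (d + d * i)"] by (simp add: power_add power_mult mult.assoc)
    show "q * q ^ d / (a * q) * (q ^ d) ^ i \<noteq> 1"
      using a[of "d + d * i"] a0 unfolding e by (auto simp: power_add power_mult)
    show "q * q ^ d / (q / a) * (q ^ d) ^ i \<noteq> 1"
      using aq[of "d + d * i"] unfolding e by (simp add: power_add power_mult mult.assoc)
  qed (use q0 a0 in auto)
  \<comment> \<open>The last factor is 1 - q q^(dm) = 1 - q^n; it yields [n] and a factor 1 - q to
    cancel.\<close>
  also have "q_poch q (q ^ d) (Suc m) = q_poch q (q ^ d) m * ((1 - q) * q_int q n)"
    unfolding q_int_mult by (simp add: q_poch_Suc n power_mult)
  finally have "(1 - q) * (\<Sum>k\<le>m. z_gen q a (q ^ n) d k) = (1 - q) * (q_int q n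
      * (q_pochs [q, q ^ (d - 1)] (q ^ d) m / q_pochs [a * q ^ d, q ^ d / a] (q ^ d) m))"
    unfolding e by (simp add: q_pochs_def ac_simps)
  then show ?thesis
    by (subst (asm) mult_left_cancel[OF q1])
qed

section \<open>Triple sums over a simplex\<close>

text \<open>The box of triples with entries at most m lies in the simplex because 3 m \<le> L, and
  any triple outside the box has a vanishing factor.\<close>

lemma sum_triples_eq_cube:
  fixes f :: "nat \<Rightarrow> 'a::comm_ring_1"
  assumes f: "\<And>k. m < k \<Longrightarrow> f k = 0" and L: "3 * m \<le> L"
  shows "(\<Sum>(i, j, k)\<in>{(i, j, k). i + j + k \<le> L}. f i * f j * f k) = (\<Sum>k\<le>m. f k) ^ 3"
proof -
  have "finite {(i, j, k). i + j + k \<le> L}"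
    by (rule finite_subset[of _ "{..L} \<times> {..L} \<times> {..L}"]) auto
  then have "(\<Sum>(i, j, k)\<in>{(i, j, k). i + j + k \<le> L}. f i * f j * f k)
      = (\<Sum>(i, j, k)\<in>{..m} \<times> {..m} \<times> {..m}. f i * f j * f k)"
  proof (rule sum.mono_neutral_right)
    show "\<forall>x\<in>{(i, j, k). i + j + k \<le> L} - {..m} \<times> {..m} \<times> {..m}.
        (case x of (i, j, k) \<Rightarrow> f i * f j * f k) = 0"
      using f by (auto simp flip: not_less)
  qed (use L in auto)
  also have "\<dots> = (\<Sum>i\<le>m. \<Sum>j\<le>m. \<Sum>k\<le>m. f i * f j * f k)"
    by (simp add: sum.cartesian_product)
  also have "\<dots> = (\<Sum>k\<le>m. f k) ^ 3"
    by (simp add: power3_eq_cube flip: sum_distrib_left sum_distrib_right)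
  finally show ?thesis .
qed

section \<open>Values of rational functions at a point\<close>

text \<open>\<open>fract_eval r x v\<close>: the rational function \<open>x\<close> has no pole at \<open>r\<close>, and takes the value \<open>v\<close> there.\<close>

definition fract_eval :: "'a::idom \<Rightarrow> 'a poly fract \<Rightarrow> 'a fract \<Rightarrow> bool" where
  "fract_eval r x v \<longleftrightarrow>
     (\<exists>N D. poly D r \<noteq> 0 \<and> x = Fract N D \<and> v = Fract (poly N r) (poly D r))"

lemma fract_evalI:
  "poly D r \<noteq> 0 \<Longrightarrow> x = Fract N D \<Longrightarrow> v = Fract (poly N r) (poly D r) \<Longrightarrow> fract_eval r x v"
  unfolding fract_eval_def by blast

lemma fract_evalE:
  assumes "fract_eval r x v"
  obtains N D where "poly D r \<noteq> 0" "D \<noteq> 0" "x = Fract N D" "v = Fract (poly N r) (poly D r)"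
  using assms unfolding fract_eval_def by (metis poly_0)

lemma to_fract_power: "to_fract (x ^ k) = to_fract x ^ k"
  by (induction k) simp_all

lemma fract_eval_to_fract: "fract_eval r (to_fract p) (to_fract (poly p r))"
  by (rule fract_evalI[of 1 _ _ p]) (simp_all add: to_fract_def)

lemma fract_eval_0: "fract_eval r 0 0"
  using fract_eval_to_fract[of r 0] by simp

lemma fract_eval_1: "fract_eval r 1 1"
  using fract_eval_to_fract[of r 1] by simp

lemma fract_eval_add:
  assumes "fract_eval r x v" "fract_eval r y w"
  shows "fract_eval r (x + y) (v + w)"
proof -
  from assms(1) obtain N D where ND: "poly D r \<noteq> 0" "D \<noteq> 0" "x = Fract N D"
    "v = Fract (poly N r) (poly D r)" by (rule fract_evalE)
  from assms(2) obtain M E where ME: "poly E r \<noteq> 0" "E \<noteq> 0" "y = Fract M E"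
    "w = Fract (poly M r) (poly E r)" by (rule fract_evalE)
  show ?thesis
    by (rule fract_evalI[of "D * E" _ _ "N * E + M * D"]) (use ND ME in simp_all)
qed

lemma fract_eval_diff:
  assumes "fract_eval r x v" "fract_eval r y w"
  shows "fract_eval r (x - y) (v - w)"
proof -
  from assms(1) obtain N D where ND: "poly D r \<noteq> 0" "D \<noteq> 0" "x = Fract N D"
    "v = Fract (poly N r) (poly D r)" by (rule fract_evalE)
  from assms(2) obtain M E where ME: "poly E r \<noteq> 0" "E \<noteq> 0" "y = Fract M E"
    "w = Fract (poly M r) (poly E r)" by (rule fract_evalE)
  show ?thesis
    by (rule fract_evalI[of "D * E" _ _ "N * E - M * D"]) (use ND ME in simp_all)
qed

lemma fract_eval_mult:
  assumes "fract_eval r x v" "fract_eval r y w"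
  shows "fract_eval r (x * y) (v * w)"
proof -
  from assms(1) obtain N D where ND: "poly D r \<noteq> 0" "D \<noteq> 0" "x = Fract N D"
    "v = Fract (poly N r) (poly D r)" by (rule fract_evalE)
  from assms(2) obtain M E where ME: "poly E r \<noteq> 0" "E \<noteq> 0" "y = Fract M E"
    "w = Fract (poly M r) (poly E r)" by (rule fract_evalE)
  show ?thesis
    by (rule fract_evalI[of "D * E" _ _ "N * M"]) (use ND ME in simp_all)
qed

text \<open>A nonzero value w means that the numerator of y is nonzero at r, so it may enter the
  denominator of x / y.\<close>

lemma fract_eval_divide:
  assumes "fract_eval r x v" "fract_eval r y w" and w: "w \<noteq> 0"
  shows "fract_eval r (x / y) (v / w)"
proof -
  from assms(1) obtain N D where ND: "poly D r \<noteq> 0" "D \<noteq> 0" "x = Fract N D"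
    "v = Fract (poly N r) (poly D r)" by (rule fract_evalE)
  from assms(2) obtain M E where ME: "poly E r \<noteq> 0" "E \<noteq> 0" "y = Fract M E"
    "w = Fract (poly M r) (poly E r)" by (rule fract_evalE)
  have "poly M r \<noteq> 0"
    using w ME by (auto simp: eq_fract Zero_fract_def)
  then show ?thesis
    by (intro fract_evalI[of "D * M" _ _ "N * E"]) (use ND ME in simp_all)
qed

lemma fract_eval_power: "fract_eval r x v \<Longrightarrow> fract_eval r (x ^ k) (v ^ k)"
  by (induction k) (auto intro: fract_eval_1 fract_eval_mult)

lemma fract_eval_sum:
  "(\<And>i. i \<in> S \<Longrightarrow> fract_eval r (f i) (g i)) \<Longrightarrow> fract_eval r (sum f S) (sum g S)"
  by (induction S rule: infinite_finite_induct) (auto intro: fract_eval_0 fract_eval_add)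

lemma fract_eval_prod:
  "(\<And>i. i \<in> S \<Longrightarrow> fract_eval r (f i) (g i)) \<Longrightarrow> fract_eval r (prod f S) (prod g S)"
  by (induction S rule: infinite_finite_induct) (auto intro: fract_eval_1 fract_eval_mult)

lemma fract_eval_q_int: "fract_eval r q q' \<Longrightarrow> fract_eval r (q_int q m) (q_int q' m)"
  unfolding q_int_def by (intro fract_eval_sum fract_eval_power)

lemma fract_eval_q_poch:
  "fract_eval r x x' \<Longrightarrow> fract_eval r q q' \<Longrightarrow> fract_eval r (q_poch x q m) (q_poch x' q' m)"
  unfolding q_poch_def
  by (intro fract_eval_prod fract_eval_diff fract_eval_mult fract_eval_power fract_eval_1)

lemma fract_eval_q_pochs:
  assumes "list_all2 (fract_eval r) xs ys" and "fract_eval r q q'"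
  shows "fract_eval r (q_pochs xs q m) (q_pochs ys q' m)"
  using assms(1)
  by induction (auto simp: q_pochs_def intro: fract_eval_1 fract_eval_mult fract_eval_q_poch assms(2))

section \<open>From equal values to congruences\<close>

text \<open>Over an integral domain no Bezout identity need exist. Instead, a common divisor c is
  nonzero at r, as D is; so the cofactor of c in X - r vanishes at r and is divisible by X - r, and
  cancelling makes c a unit.\<close>

lemma coprime_linear_poly:
  fixes r :: "'a::idom_divide"
  assumes "poly D r \<noteq> 0"
  shows "coprime D [:- r, 1:]"
proof (rule coprimeI)
  fix c assume "c dvd D" "c dvd [:- r, 1:]"
  then obtain e where e: "[:- r, 1:] = c * e" by blast
  have "poly c r \<noteq> 0"
    using assms \<open>c dvd D\<close> by auto
  moreover have "poly c r * poly e r = poly [:- r, 1:] r"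
    unfolding e by simp
  ultimately have "[:- r, 1:] dvd e"
    by (simp add: poly_eq_0_iff_dvd)
  then obtain f where "e = [:- r, 1:] * f" by blast
  with e have "[:- r, 1:] * (c * f) = [:- r, 1:] * 1"
    by (simp only: mult.left_commute mult_1_right)
  then have "c * f = 1"
    by (subst (asm) mult_left_cancel) auto
  then show "c dvd 1" by (metis dvd_triv_left)
qed

text \<open>The difference has value 0, so its numerator has the root r, while its denominator is
  nonzero at r.\<close>

lemma fract_cong_if_fract_eval:
  fixes r :: "'a::idom_divide"
  assumes "fract_eval r A v" and "fract_eval r B v"
  shows "fract_cong A B [:- r, 1:]"
proof -
  have "fract_eval r (A - B) 0"
    using fract_eval_diff[OF assms] by simp
  then obtain N D where "poly D r \<noteq> 0" "D \<noteq> 0" "A - B = Fract N D" "0 = Fract (poly N r) (poly D r)"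
    by (rule fract_evalE)
  moreover from this have "[:- r, 1:] dvd N"
    by (simp add: poly_eq_0_iff_dvd[symmetric] Zero_fract_def eq_fract)
  ultimately show ?thesis
    unfolding fract_cong_def using coprime_linear_poly by blast
qed

section \<open>The congruence modulo b - q^n\<close>

theorem lemma2p3:
  fixes n d :: nat
  assumes "n > 0" and "d \<ge> 3" and "[n = 1] (mod d)"
  shows "fract_cong
           (\<Sum>(i, j, k)\<in>{(i, j, k). i + j + k \<le> n - 1}. z_q d i * z_q d j * z_q d k)
           (q_int varq n ^ 3
             * (q_pochs [varq, varq ^ (d - 1)] (varq ^ d) ((n - 1) div d) ^ 3
                / q_pochs [vara * varq ^ d, varq ^ d / vara] (varq ^ d) ((n - 1) div d) ^ 3))
           (polyb - polyq ^ n)"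
proof -
  define m where "m = (n - 1) div d"
  have "d dvd n - 1"
    using assms by (metis Suc_leI One_nat_def cong_altdef_nat)
  then have n: "n = Suc (d * m)"
    using assms by (simp add: m_def)
  \<comment> \<open>\<open>r\<close> is q^n in Z[q][a], the root of b - q^n as a polynomial in b;
    \<open>q\<close> and \<open>a\<close> are the remaining indeterminates in the field of
    values.\<close>
  define r :: "int poly poly" where "r = [:[:0, 1:]:] ^ n"
  define q :: "int poly poly fract" where "q = to_fract [:[:0, 1:]:]"
  define a :: "int poly poly fract" where "a = to_fract [:0, 1:]"
  have const_power: "[:c:] ^ i = [:c ^ i:]" for c :: "int poly" and i
    by (induction i) simp_all
  \<comment> \<open>With powers of q as monomials, q^i \<noteq> 1 follows from degrees in q for i >
    0; a q^i \<noteq> 1 and a \<noteq> q^i hold because q^i is constant in a.\<close>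
  have q_power: "q ^ i = to_fract [:monom 1 i:]" for i
    by (simp add: q_def const_power to_fract_power[symmetric] monom_altdef)
  have q0: "q \<noteq> 0" and a0: "a \<noteq> 0"
    by (simp_all add: q_def a_def)
  have q: "q ^ i \<noteq> 1" if "i > 0" for i
  proof -
    have "monom (1::int) i \<noteq> [:1:]"
      using that by (auto dest!: arg_cong[where f = degree] simp: degree_monom_eq)
    then show ?thesis
      unfolding q_power by (simp flip: to_fract_1 add: one_pCons)
  qed
  have aq: "a * q ^ i \<noteq> 1" for i
    unfolding q_power a_def by (simp flip: to_fract_1 to_fract_mult add: one_pCons)
  have a: "a \<noteq> q ^ i" for i
    unfolding q_power a_def by simp
  have ev_q: "fract_eval r varq q"
    using fract_eval_to_fract[of r polyq] by (simp add: varq_def polyq_def q_def)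
  have ev_a: "fract_eval r vara a"
    using fract_eval_to_fract[of r "[:[:0, 1:]:]"] by (simp add: vara_def a_def)
  have ev_b: "fract_eval r varb (q ^ n)"
    using fract_eval_to_fract[of r polyb] by (simp add: varb_def polyb_def q_def r_def to_fract_power)
  \<comment> \<open>A vanishing factor would force q^j = 1 with j > 0, a q^j = 1 or a = q^j.\<close>
  have den: "q_poch (q ^ d) (q ^ d) k \<noteq> 0" "q_poch (a * q ^ d) (q ^ d) k \<noteq> 0"
    "q_poch (q ^ d / a) (q ^ d) k \<noteq> 0" "q_poch (q ^ n * q ^ d) (q ^ d) k \<noteq> 0" for k
  proof (rule_tac [!] q_poch_nonzero)
    fix i
    show "q ^ d * (q ^ d) ^ i \<noteq> 1"
      using q[of "d + d * i"] assms by (simp add: power_add power_mult)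
    show "a * q ^ d * (q ^ d) ^ i \<noteq> 1"
      using aq[of "d + d * i"] by (simp add: power_add power_mult mult.assoc)
    show "q ^ d / a * (q ^ d) ^ i \<noteq> 1"
      using a[of "d + d * i"] a0 by (auto simp: power_add power_mult)
    show "q ^ n * q ^ d * (q ^ d) ^ i \<noteq> 1"
      using q[of "n + d + d * i"] assms by (simp add: power_add power_mult)
  qed
  note ev = fract_eval_mult fract_eval_divide fract_eval_power fract_eval_q_int fract_eval_q_pochs
    ev_q ev_a ev_b
  have ev_z: "fract_eval r (z_q d k) (z_gen q a (q ^ n) d k)" for k
    unfolding z_q_eq_z_gen z_gen_def
    \<comment> \<open>The side conditions are nonzero denominators: those in \<open>den\<close>, and
      the values a and q^n dividing q in q / a and q / b.\<close>
    by (intro ev list.rel_intros) (use den q0 a0 in \<open>simp_all add: q_pochs_def\<close>)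
  have "fract_eval r (\<Sum>(i, j, k)\<in>{(i, j, k). i + j + k \<le> n - 1}. z_q d i * z_q d j * z_q d k)
      (\<Sum>(i, j, k)\<in>{(i, j, k). i + j + k \<le> n - 1}.
         z_gen q a (q ^ n) d i * z_gen q a (q ^ n) d j * z_gen q a (q ^ n) d k)"
    by (rule fract_eval_sum) (auto intro: fract_eval_mult ev_z)
  also have "(\<Sum>(i, j, k)\<in>{(i, j, k). i + j + k \<le> n - 1}.
        z_gen q a (q ^ n) d i * z_gen q a (q ^ n) d j * z_gen q a (q ^ n) d k)
      = (\<Sum>k\<le>m. z_gen q a (q ^ n) d k) ^ 3"
    using assms by (intro sum_triples_eq_cube z_gen_eq_0[OF q0 n]) (simp_all add: n)
  also have "\<dots> = q_int q n ^ 3 * (q_pochs [q, q ^ (d - 1)] (q ^ d) m ^ 3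
      / q_pochs [a * q ^ d, q ^ d / a] (q ^ d) m ^ 3)"
    using assms by (subst sum_z_gen[OF q0 a0 q aq a _ n]) (simp_all add: power_mult_distrib power_divide)
  finally have "fract_eval r
      (\<Sum>(i, j, k)\<in>{(i, j, k). i + j + k \<le> n - 1}. z_q d i * z_q d j * z_q d k) \<dots>" .
  moreover have "fract_eval r (q_int varq n ^ 3 * (q_pochs [varq, varq ^ (d - 1)] (varq ^ d) m ^ 3
        / q_pochs [vara * varq ^ d, varq ^ d / vara] (varq ^ d) m ^ 3))
      (q_int q n ^ 3 * (q_pochs [q, q ^ (d - 1)] (q ^ d) m ^ 3
        / q_pochs [a * q ^ d, q ^ d / a] (q ^ d) m ^ 3))"
    by (intro ev list.rel_intros) (use den a0 in \<open>simp_all add: q_pochs_def\<close>)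
  moreover have "polyb - polyq ^ n = [:- r, 1:]"
  proof -
    have "[:c:] ^ n = [:c ^ n:]" for c :: "int poly poly"
      by (induction n) simp_all
    then show ?thesis
      by (simp add: polyb_def polyq_def r_def)
  qed
  ultimately show ?thesis
    unfolding m_def[symmetric] using fract_cong_if_fract_eval by metis
qed

end
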